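(* For each integer $n\ge 2$, let $\sigma$ be chosen uniformly at random from the set $S_n$ of all permutations of $\{1,2,\ldots,n\}$ (each permutation having probability $1/n!$; write $\mathbb{P}$ for this probability measure), and let $s_n=s_n(\sigma)=\sum_{c\in C_n(\sigma)} l(c)$ be the sum, over all cycles $c$ of $\sigma$, of the length $l(c)$ of the initial longest increasing sequence of $c$, where each cycle is written starting with its minimum element. Let $$s_n^\prime:=\frac{s_n-e\log n}{\sqrt{3e\log n}},$$ where $e$ is the base of the natural logarithm $\log$. Then $s_n^\prime$ converges in distribution to a standard normal random variable as $n\to\infty$, i.e., for every real $u$, $$\lim_{n\to\infty}\mathbb{P}(s_n^\prime\le u)=\frac{1}{\sqrt{2\pi}}\int_{-\infty}^u e^{-v^2/2}\,dv.$$
   Context: For $\sigma\in S_n$, $C_n(\sigma)$ denotes the set of all cycles of $\sigma$ in its disjoint cycle decomposition, fixed points included as cycles of length $1$. Each cycle $c$ of length $k$ is written as a sequence $c=(a_1,a_2,\ldots,a_k)$ with $a_1=\min\{a_1,\ldots,a_k\}$, $a_{i+1}=\sigma(a_i)$ for $1\le i<k$, and $\sigma(a_k)=a_1$. The length $l(c)$ of the initial longest increasing sequence (ILIS) of $c=(a_1,\ldots,a_k)$ is defined as follows: $l(c)=m$ with $1\le m\le k-1$ if $a_1<a_2<\cdots<a_m$ and $a_m>a_{m+1}$; and $l(c)=k$ if $a_1<a_2<\cdots<a_k$. Equivalently, $l(c)$ is the largest $m\le k$ such that $a_1<a_2<\cdots<a_m$. Example: the permutation of $\{1,\ldots,7\}$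 with one-line form $(1,3,5,4,7,6,2)$ has cycles $(1),(2,3,5,7),(4),(6)$, so $s_7=1+4+1+1=7$. *)

theory Defs
  imports "HOL-Probability.Probability"
begin

definition cycles_of_perm :: "nat \<Rightarrow> (nat \<Rightarrow> nat) \<Rightarrow> nat list set" where
  "cycles_of_perm n \<sigma> =
     {c. c \<noteq> [] \<and> distinct c \<and> set c \<subseteq> {1..n} \<and> hd c = Min (set c) \<and>
         (\<forall>i. Suc i < length c \<longrightarrow> c ! Suc i = \<sigma> (c ! i)) \<and> \<sigma> (last c) = hd c}"

definition ilis_length :: "nat list \<Rightarrow> nat" where
  "ilis_length c = (GREATEST m. m \<le> length c \<and> sorted_wrt (<) (take m c))"

definition ilis_sum :: "nat \<Rightarrow> (nat \<Rightarrow> nat) \<Rightarrow> nat" where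
  "ilis_sum n \<sigma> = (\<Sum>c\<in>cycles_of_perm n \<sigma>. ilis_length c)"

(* Only meaningful for n \<ge> 2: the denominator is 0 for n \<le> 1. *)
definition ilis_sum_normalized :: "nat \<Rightarrow> (nat \<Rightarrow> nat) \<Rightarrow> real" where
  "ilis_sum_normalized n \<sigma> =
     (real (ilis_sum n \<sigma>) - exp 1 * ln (real n)) / sqrt (3 * exp 1 * ln (real n))"

definition uniform_perm :: "nat \<Rightarrow> (nat \<Rightarrow> nat) pmf" where
  "uniform_perm n = pmf_of_set {\<sigma>. \<sigma> permutes {1..n}}"

end

theory Submission
  imports Defs "HOL-Combinatorics.Cycles" "HOL-Real_Asymp.Real_Asymp"
begin

text \<open>
  The proof computes the characteristic function of $s_n$ and applies Levy's continuity theorem.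

  Put $z = e^{i\theta}$ and $a_n = \mathbb{E} z^{s_n}$. In a uniform permutation of an $n$-element set
  the cycle through the minimum has length uniform on $1, \ldots, n$. Given its elements it is a
  uniform cycle on them, and the rest is an independent uniform permutation of the remaining set.
  Hence $n a_n = \sum_{k=1}^n f_k a_{n-k}$ (\<open>sum_permutations_power_ilis\<close>), where $f_k$ is the
  generating function of $l(c)$ for a uniform cycle $c$ of length $k$. For $j < k$ the entries in
  positions $2, \ldots, j+1$ of $c$ are increasing with probability $1/j!$, which gives
  $f_k = 1 + (z-1) \sum_{j<k} z^j/j!$. This converges very fast to $F = 1 + w$ with
  $w = (z-1) e^z$.

  Replacing every $f_k$ by $F$ turns the recursion into one that is solved explicitly by
  $p_n = \prod_{k=1}^n (1 + w/k)$. A comparison of the two recursions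
  (\<open>norm_diff_le_of_renewal\<close>) shows $|a_n - p_n| \le \sum_k |f_k - F| \le e |z-1|$, uniformly
  in $n$, and this tends to $0$ as $\theta \to 0$. The comparison works because
  $|f_k|, |F|, |p_n| \le 1$.

  Finally $p_n$ is close to $\exp(w H_n)$, where $H_n$ is the harmonic number, and
  $w = i e \theta - \frac{3e}{2} \theta^2 + O(\theta^3)$. With $\theta = t / \sqrt{3 e \log n}$ the
  first term produces the centring $e \log n$ and the second one the factor $e^{-t^2/2}$.
\<close>

section \<open>Cycles as lists\<close>

text \<open>For an arbitrary ground set, because removing a cycle from a permutation of an initial segment of
  the numbers leaves a set with gaps.\<close>

definition cycle_lists :: "nat set \<Rightarrow> (nat \<Rightarrow> nat) \<Rightarrow> nat list set" where
  "cycle_lists S \<sigma> = {c. c \<noteq> [] \<and> distinct c \<and> set c \<subseteq> S \<and> hd c = Min (set c) \<and> map \<sigma> c = rotate1 c}"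

lemma map_eq_rotate1_iff:
  assumes "c \<noteq> []"
  shows "map \<sigma> c = rotate1 c \<longleftrightarrow> (\<forall>i. Suc i < length c \<longrightarrow> c ! Suc i = \<sigma> (c ! i)) \<and> \<sigma> (last c) = hd c"
proof -
  have "map \<sigma> c = rotate1 c \<longleftrightarrow> (\<forall>i<length c. \<sigma> (c ! i) = c ! (Suc i mod length c))"
    by (auto simp: list_eq_iff_nth_eq nth_rotate1)
  also have "\<dots> \<longleftrightarrow> (\<forall>i. Suc i < length c \<longrightarrow> c ! Suc i = \<sigma> (c ! i)) \<and> \<sigma> (c ! (length c - 1)) = c ! 0"
  proof safe
    fix i assume *: "\<forall>i. Suc i < length c \<longrightarrow> c ! Suc i = \<sigma> (c ! i)" "\<sigma> (c ! (length c - 1)) = c ! 0" "i < length c"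
    show "\<sigma> (c ! i) = c ! (Suc i mod length c)"
    proof (cases "Suc i < length c")
      case True
      then show ?thesis using *(1) by simp
    next
      case False
      then have "length c = Suc i" using *(3) by simp
      then show ?thesis using *(2) by simp
    qed
  qed (use assms in auto)
  finally show ?thesis using assms by (simp add: last_conv_nth hd_conv_nth)
qed

lemma cycles_of_perm_eq: "cycles_of_perm n \<sigma> = cycle_lists {1..n} \<sigma>"
  unfolding cycles_of_perm_def cycle_lists_def using map_eq_rotate1_iff by blast

lemma map_funpow_eq_rotate:
  assumes "map \<sigma> c = rotate1 c"
  shows "map (\<sigma> ^^ i) c = rotate i c"
proof (induction i)
  case (Suc i)
  have "map (\<sigma> ^^ Suc i) c = map \<sigma> (rotate i c)" by (simp add: Suc[symmetric] comp_def)
  also have "\<dots> = rotate i (rotate1 c)" by (simp add: rotate_map[symmetric] assms)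
  finally show ?case by (simp only: rotate1_rotate_swap rotate_Suc)
qed simp

lemma nth_eq_funpow_hd:
  assumes "map \<sigma> c = rotate1 c" "i < length c"
  shows "c ! i = (\<sigma> ^^ i) (hd c)"
proof -
  have "c \<noteq> []" using assms by auto
  then have "(\<sigma> ^^ i) (hd c) = hd (map (\<sigma> ^^ i) c)" by (simp add: hd_map)
  also have "\<dots> = c ! i"
    using assms \<open>c \<noteq> []\<close> by (simp add: map_funpow_eq_rotate hd_rotate_conv_nth)
  finally show ?thesis ..
qed

text \<open>A cycle list is determined by the permutation and its first element: it lists the orbit of that
  element until the first return, and distinctness forbids stopping later.\<close>

lemma cycle_eq_support:
  assumes \<sigma>: "permutation \<sigma>" and c: "c \<noteq> []" "distinct c" "map \<sigma> c = rotate1 c"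
  shows "c = support \<sigma> (hd c)"
proof -
  have "(\<sigma> ^^ length c) (hd c) = hd c"
    using map_funpow_eq_rotate[OF c(3), of "length c"] hd_map[OF c(1), of "\<sigma> ^^ length c"] by simp
  then have le: "least_power \<sigma> (hd c) \<le> length c"
    using c(1) by (intro least_power_le) auto
  have "least_power \<sigma> (hd c) = length c"
  proof (rule ccontr)
    assume "\<not> ?thesis"
    with le have less: "least_power \<sigma> (hd c) < length c" by simp
    then have "c ! least_power \<sigma> (hd c) = (\<sigma> ^^ least_power \<sigma> (hd c)) (hd c)"
      by (rule nth_eq_funpow_hd[OF c(3)])
    also have "\<dots> = hd c" by (rule least_power_of_permutation(1)[OF \<sigma>])
    also have "\<dots> = c ! 0" using c(1) by (rule hd_conv_nth)
    finally have "c ! least_power \<sigma> (hd c) = c ! 0" .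
    then show False
      using c(2) less least_power_of_permutation(2)[OF \<sigma>, of "hd c"] by (subst (asm) nth_eq_iff_index_eq) auto
  qed
  then show ?thesis
    by (intro nth_equalityI) (auto simp: nth_eq_funpow_hd[OF c(3)])
qed

lemma map_support_eq_rotate1:
  assumes \<sigma>: "permutation \<sigma>"
  shows "map \<sigma> (support \<sigma> a) = rotate1 (support \<sigma> a)"
proof -
  have "map \<sigma> (support \<sigma> a) = map (cycle_of_list (support \<sigma> a)) (support \<sigma> a)"
    by (intro map_cong refl cycle_restrict[OF \<sigma>])
  also have "\<dots> = rotate1 (support \<sigma> a)"
    using cyclic_rotation[OF cycle_of_permutation[OF \<sigma>], of 1] by simp
  finally show ?thesis .
qed

lemma support_subset:
  assumes "\<sigma> permutes S" "a \<in> S"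
  shows "set (support \<sigma> a) \<subseteq> S"
  using assms permutes_in_image[OF permutes_funpow[OF assms(1)]] by auto

lemma finite_cycle_lists:
  assumes "finite S"
  shows "finite (cycle_lists S \<sigma>)"
  by (rule finite_subset[OF _ finite_subset_distinct[OF assms]]) (auto simp: cycle_lists_def)

text \<open>Multiplying by a cycle on fresh points adds this cycle and leaves the others alone, since two cycles
  of a permutation with a common point have the same points and hence the same minimum.\<close>

lemma cycle_lists_peel:
  assumes S: "finite S" and c: "c \<noteq> []" "distinct c" "set c \<subseteq> S" "hd c = Min (set c)" and \<tau>: "\<tau> permutes (S - set c)"
  shows "cycle_lists S (cycle_of_list c \<circ> \<tau>) = insert c (cycle_lists (S - set c) \<tau>)"
proof -
  define \<sigma> where "\<sigma> = cycle_of_list c \<circ> \<tau>"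
  have "cycle_of_list c permutes S"
    using cycle_permutes[of c] c(3) by (rule permutes_subset)
  moreover have "\<tau> permutes S" using \<tau> by (rule permutes_subset) auto
  ultimately have \<sigma>S: "\<sigma> permutes S" unfolding \<sigma>_def by (rule permutes_compose[rotated])
  then have \<sigma>: "permutation \<sigma>" using S by (auto simp: permutation_permutes)
  have "map \<sigma> c = map (cycle_of_list c) c"
    by (intro map_cong refl) (use permutes_not_in[OF \<tau>] in \<open>auto simp: \<sigma>_def\<close>)
  also have "\<dots> = rotate1 c"
    using cyclic_rotation[OF c(2), of 1] by simp
  finally have map_c: "map \<sigma> c = rotate1 c" .
  have c_supp: "c = support \<sigma> (hd c)" by (rule cycle_eq_support[OF \<sigma> c(1,2) map_c])
  have outside: "\<sigma> x = \<tau> x" if "x \<in> S - set c" for x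
    using that permutes_in_image[OF \<tau>, of x] by (simp add: \<sigma>_def id_outside_supp)
  have map_outside: "map \<sigma> d = map \<tau> d" if "set d \<subseteq> S - set c" for d
    by (intro map_cong refl outside) (use that in auto)
  show ?thesis unfolding \<sigma>_def[symmetric]
  proof (intro equalityI subsetI)
    fix d assume d: "d \<in> cycle_lists S \<sigma>"
    then have d_supp: "d = support \<sigma> (hd d)"
      by (intro cycle_eq_support[OF \<sigma>]) (auto simp: cycle_lists_def)
    show "d \<in> insert c (cycle_lists (S - set c) \<tau>)"
    proof (cases "hd d \<in> set c")
      case True
      have "set d = set c"
      proof (rule ccontr)
        assume "set d \<noteq> set c"
        moreover have "set d \<in> range (\<lambda>a. set (support \<sigma> a))"
          by (subst d_supp) (rule rangeI)
        moreover have "set c \<in> range (\<lambda>a. set (support \<sigma> a))"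
          by (subst c_supp) (rule rangeI)
        ultimately have "set d \<inter> set c = {}"
          using disjointD[OF disjoint_support[OF \<sigma>]] by blast
        moreover have "hd d \<in> set d" using d by (simp add: cycle_lists_def)
        ultimately show False using True by blast
      qed
      then have hd_eq: "hd d = hd c" using d c(4) by (simp add: cycle_lists_def)
      have "d = support \<sigma> (hd d)" by (rule d_supp)
      also have "\<dots> = c" unfolding hd_eq by (rule c_supp[symmetric])
      finally show ?thesis by simp
    next
      case False
      then have disj: "set d \<inter> set c = {}"
        using disjoint_support'[OF \<sigma>, of "hd d" "hd c"]
        unfolding c_supp[symmetric] d_supp[symmetric] by blast
      then have sub: "set d \<subseteq> S - set c" using d by (auto simp: cycle_lists_def)
      then show ?thesis using d map_outside[OF sub] by (simp add: cycle_lists_def)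
    qed
  next
    fix d assume "d \<in> insert c (cycle_lists (S - set c) \<tau>)"
    then show "d \<in> cycle_lists S \<sigma>"
    proof
      assume "d = c"
      then show ?thesis using map_c c by (simp add: cycle_lists_def)
    next
      assume d: "d \<in> cycle_lists (S - set c) \<tau>"
      then have sub: "set d \<subseteq> S - set c" by (simp add: cycle_lists_def)
      then have "set d \<subseteq> S" by blast
      with d map_outside[OF sub] show ?thesis by (simp add: cycle_lists_def)
    qed
  qed
qed

section \<open>The cycle through the minimum\<close>

definition cycles_from_min :: "nat set \<Rightarrow> nat list set" where
  "cycles_from_min S = {c. c \<noteq> [] \<and> distinct c \<and> set c \<subseteq> S \<and> hd c = Min S}"

text \<open>The decomposition of a permutation into the cycle through the minimum and a permutation of the
  remaining points, as an identity between sums.\<close>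

lemma sum_permutations_split_min_cycle:
  fixes g :: "(nat \<Rightarrow> nat) \<Rightarrow> 'a::comm_monoid_add"
  assumes S: "finite S" "S \<noteq> {}"
  shows "(\<Sum>\<sigma> | \<sigma> permutes S. g \<sigma>) =
    (\<Sum>c\<in>cycles_from_min S. \<Sum>\<tau> | \<tau> permutes (S - set c). g (cycle_of_list c \<circ> \<tau>))"
proof -
  let ?h = "\<lambda>\<sigma>. support \<sigma> (Min S)"
  have perm: "permutation \<sigma>" if "\<sigma> permutes S" for \<sigma>
    using S that by (auto simp: permutation_permutes)
  have "finite {c. set c \<subseteq> S \<and> distinct c}"
    using S(1) by (rule finite_subset_distinct)
  then have fin: "finite (cycles_from_min S)"
    by (rule finite_subset[rotated]) (auto simp: cycles_from_min_def)
  have hd: "support \<sigma> a \<noteq> []" "hd (support \<sigma> a) = a" if "\<sigma> permutes S" for \<sigma> a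
    using least_power_of_permutation(2)[OF perm[OF that], of a] by (auto simp: hd_map hd_upt)
  have img: "?h ` {\<sigma>. \<sigma> permutes S} \<subseteq> cycles_from_min S"
  proof (intro image_subsetI)
    fix \<sigma> assume "\<sigma> \<in> {\<sigma>. \<sigma> permutes S}"
    then have \<sigma>: "\<sigma> permutes S" by simp
    show "?h \<sigma> \<in> cycles_from_min S"
      using hd[OF \<sigma>] support_subset[OF \<sigma> Min_in[OF S]] cycle_of_permutation[OF perm[OF \<sigma>]]
      unfolding cycles_from_min_def mem_Collect_eq by (intro conjI)
  qed
  \<comment> \<open>Group the permutations by the cycle through the minimum. Left multiplication by the inverse of
    that cycle makes its elements fixed points and so reduces to a permutation of the rest.\<close>
  have "(\<Sum>\<sigma> | \<sigma> permutes S. g \<sigma>) = (\<Sum>c\<in>cycles_from_min S. \<Sum>\<sigma>\<in>{\<sigma>. \<sigma> \<in> {\<sigma>. \<sigma> permutes S} \<and> ?h \<sigma> = c}. g \<sigma>)"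
    using sum.group[OF finite_permutations[OF S(1)] fin img, of g] by simp
  also have "\<dots> = (\<Sum>c\<in>cycles_from_min S. \<Sum>\<tau> | \<tau> permutes (S - set c). g (cycle_of_list c \<circ> \<tau>))"
  proof (rule sum.cong[OF refl])
    fix c assume "c \<in> cycles_from_min S"
    then have c: "c \<noteq> []" "distinct c" "set c \<subseteq> S" "hd c = Min S" by (auto simp: cycles_from_min_def)
    let ?C = "cycle_of_list c"
    have C: "?C permutes S" using cycle_permutes[of c] c(3) by (rule permutes_subset)
    have rot: "map ?C c = rotate1 c" using cyclic_rotation[OF c(2), of 1] by simp
    show "(\<Sum>\<sigma>\<in>{\<sigma>. \<sigma> \<in> {\<sigma>. \<sigma> permutes S} \<and> ?h \<sigma> = c}. g \<sigma>) = (\<Sum>\<tau> | \<tau> permutes (S - set c). g (?C \<circ> \<tau>))"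
    proof (rule sum.reindex_bij_witness[of _ "\<lambda>\<tau>. ?C \<circ> \<tau>" "\<lambda>\<sigma>. inv ?C \<circ> \<sigma>"])
      fix \<sigma> assume "\<sigma> \<in> {\<sigma>. \<sigma> \<in> {\<sigma>. \<sigma> permutes S} \<and> ?h \<sigma> = c}"
      then have \<sigma>: "\<sigma> permutes S" "?h \<sigma> = c" by auto
      show "?C \<circ> (inv ?C \<circ> \<sigma>) = \<sigma>"
        by (simp add: fun_eq_iff permutes_inverses[OF C])
      show "g (?C \<circ> (inv ?C \<circ> \<sigma>)) = g \<sigma>"
        by (simp add: comp_assoc[symmetric] permutes_inv_o[OF C])
      have "map \<sigma> c = map ?C c"
        using map_support_eq_rotate1[OF perm[OF \<sigma>(1)], of "Min S"] \<sigma>(2) rot by simp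
      then have "inv ?C (\<sigma> x) = x" if "x \<in> set c" for x
        using that permutes_inverses[OF C] by simp
      moreover have "inv ?C \<circ> \<sigma> permutes S"
        using permutes_compose[OF \<sigma>(1) permutes_inv[OF C]] .
      ultimately show "inv ?C \<circ> \<sigma> \<in> {\<tau>. \<tau> permutes (S - set c)}"
        by (auto intro: permutes_superset)
    next
      fix \<tau> assume "\<tau> \<in> {\<tau>. \<tau> permutes (S - set c)}"
      then have \<tau>: "\<tau> permutes (S - set c)" by simp
      show "inv ?C \<circ> (?C \<circ> \<tau>) = \<tau>"
        by (simp add: fun_eq_iff permutes_inverses[OF C])
      have "\<tau> permutes S" using \<tau> by (rule permutes_subset) auto
      then have \<sigma>: "?C \<circ> \<tau> permutes S" using C by (rule permutes_compose)
      have "map (?C \<circ> \<tau>) c = map ?C c"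
        by (intro map_cong refl) (use permutes_not_in[OF \<tau>] in auto)
      then have "c = support (?C \<circ> \<tau>) (hd c)"
        using c rot by (intro cycle_eq_support[OF perm[OF \<sigma>]]) auto
      then show "?C \<circ> \<tau> \<in> {\<sigma>. \<sigma> \<in> {\<sigma>. \<sigma> permutes S} \<and> ?h \<sigma> = c}"
        using \<sigma> c(4) by simp
    qed
  qed
  finally show ?thesis .
qed

section \<open>Initial increasing sequences of a random cycle\<close>

lemma ilis_length_le: "ilis_length c \<le> length c"
  and sorted_take_iff_le_ilis_length:
    "m \<le> length c \<Longrightarrow> sorted_wrt (<) (take m c) \<longleftrightarrow> m \<le> ilis_length c"
proof -
  let ?P = "\<lambda>m. m \<le> length c \<and> sorted_wrt (<) (take m c)"
  have l: "?P (ilis_length c)"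
    unfolding ilis_length_def by (rule GreatestI_nat[of ?P 0 "length c"]) auto
  then show "ilis_length c \<le> length c" by simp
  assume m: "m \<le> length c"
  show "sorted_wrt (<) (take m c) \<longleftrightarrow> m \<le> ilis_length c"
  proof
    assume "sorted_wrt (<) (take m c)"
    then show "m \<le> ilis_length c"
      unfolding ilis_length_def using m by (intro Greatest_le_nat[of ?P m "length c"]) auto
  next
    assume "m \<le> ilis_length c"
    then have "take m c = take m (take (ilis_length c) c)" by (simp add: min_absorb1)
    with l show "sorted_wrt (<) (take m c)" by (metis sorted_wrt_take)
  qed
qed

text \<open>A geometric sum turns the power into indicators of sorted prefixes, which can be counted one by one.
  The leading minimum is smaller than everything else, so it never breaks a sorted prefix.\<close>

lemma power_ilis_length_Cons:
  fixes z :: complex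
  assumes "\<And>x. x \<in> set xs \<Longrightarrow> a < x"
  shows "z ^ ilis_length (a # xs) =
    1 + (z - 1) * (\<Sum>j<Suc (length xs). if sorted_wrt (<) (take j xs) then z ^ j else 0)"
proof -
  have "sorted_wrt (<) (take j xs) \<longleftrightarrow> j < ilis_length (a # xs)" if "j < Suc (length xs)" for j
  proof -
    have "sorted_wrt (<) (take (Suc j) (a # xs)) \<longleftrightarrow> sorted_wrt (<) (take j xs)"
      using assms by (auto dest: in_set_takeD)
    then show ?thesis using sorted_take_iff_le_ilis_length[of "Suc j" "a # xs"] that by auto
  qed
  then have "(\<Sum>j<Suc (length xs). if sorted_wrt (<) (take j xs) then z ^ j else 0) =
      (\<Sum>j<Suc (length xs). if j < ilis_length (a # xs) then z ^ j else 0)"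
    by (intro sum.cong) auto
  also have "\<dots> = (\<Sum>j<ilis_length (a # xs). z ^ j)"
    using ilis_length_le[of "a # xs"] by (intro sum.mono_neutral_cong_right) auto
  finally have sum_eq: "(\<Sum>j<Suc (length xs). if sorted_wrt (<) (take j xs) then z ^ j else 0) =
      (\<Sum>j<ilis_length (a # xs). z ^ j)" .
  have "z ^ ilis_length (a # xs) = 1 + (z - 1) * (\<Sum>j<ilis_length (a # xs). z ^ j)"
    by (simp add: power_diff_1_eq[symmetric])
  then show ?thesis unfolding sum_eq .
qed

text \<open>Among the arrangements of \<open>q\<close> elements of \<open>U\<close>, exactly one in \<open>j!\<close> has its first \<open>j\<close> entries sorted.\<close>

lemma card_lists_sorted_prefix:
  fixes U :: "'a::linorder set"
  assumes U: "finite U" and "j \<le> q" "q \<le> card U"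
  shows "card {xs. length xs = q \<and> distinct xs \<and> set xs \<subseteq> U \<and> sorted_wrt (<) (take j xs)}
    * (fact (card U - q) * fact j) = fact (card U)"
  using assms(2,3)
proof (induction q rule: dec_induct)
  case base
  \<comment> \<open>A completely sorted list is determined by its set of entries.\<close>
  have "bij_betw set {xs. length xs = j \<and> distinct xs \<and> set xs \<subseteq> U \<and> sorted_wrt (<) (take j xs)} {T. T \<subseteq> U \<and> card T = j}"
  proof (rule bij_betw_byWitness[where f' = sorted_list_of_set])
    show "\<forall>xs\<in>{xs. length xs = j \<and> distinct xs \<and> set xs \<subseteq> U \<and> sorted_wrt (<) (take j xs)}. sorted_list_of_set (set xs) = xs"
      by (auto intro!: sorted_list_of_set.idem_if_sorted_distinct simp: strict_sorted_iff)
    show "\<forall>T\<in>{T. T \<subseteq> U \<and> card T = j}. set (sorted_list_of_set T) = T"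
      using finite_subset[OF _ U] by auto
    show "sorted_list_of_set ` {T. T \<subseteq> U \<and> card T = j} \<subseteq> {xs. length xs = j \<and> distinct xs \<and> set xs \<subseteq> U \<and> sorted_wrt (<) (take j xs)}"
      using finite_subset[OF _ U] by auto
  qed (auto simp: distinct_card)
  then have "card {xs. length xs = j \<and> distinct xs \<and> set xs \<subseteq> U \<and> sorted_wrt (<) (take j xs)} = card U choose j"
    using n_subsets[OF U] by (simp add: bij_betw_same_card)
  then show ?case using binomial_fact_lemma[OF base] by (simp add: algebra_simps)
next
  case (step q)
  let ?L = "\<lambda>q. {xs. length xs = q \<and> distinct xs \<and> set xs \<subseteq> U \<and> sorted_wrt (<) (take j xs)}"
  \<comment> \<open>Beyond the sorted prefix any unused element may be appended.\<close>
  have "bij_betw (\<lambda>(xs, x). xs @ [x]) (SIGMA xs:?L q. U - set xs) (?L (Suc q))"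
    by (rule bij_betw_byWitness[where f' = "\<lambda>ys. (butlast ys, last ys)"])
       (use step.hyps in \<open>auto simp: length_Suc_conv_rev\<close>)
  then have "card (?L (Suc q)) = card (SIGMA xs:?L q. U - set xs)"
    by (simp add: bij_betw_same_card)
  also have "\<dots> = (\<Sum>xs\<in>?L q. card (U - set xs))"
    using U by (intro card_SigmaI) (auto intro: finite_subset[OF _ finite_subset_distinct[OF U]])
  also have "\<dots> = (\<Sum>xs\<in>?L q. card U - q)"
    using U by (intro sum.cong refl) (auto simp: card_Diff_subset distinct_card finite_subset)
  finally have *: "card (?L (Suc q)) = card (?L q) * (card U - q)" by simp
  have "fact (card U - q) = (card U - q) * fact (card U - Suc q)"
    using step.prems by (metis Suc_diff_Suc Suc_le_eq fact_Suc of_nat_id)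
  then show ?case using step * by (simp add: algebra_simps)
qed

text \<open>The probability generating function of the initial increasing sequence of a uniform cycle of length
  \<open>k\<close>, in the form $1 + (z-1) \sum_j z^j P(l > j)$.\<close>

definition ilis_cycle_pgf :: "complex \<Rightarrow> nat \<Rightarrow> complex" where
  "ilis_cycle_pgf z k = 1 + (z - 1) * (\<Sum>j<k. z ^ j / fact j)"

lemma sum_lists_power_ilis_length:
  fixes z :: complex
  assumes U: "finite U" and q: "q \<le> card U" and a: "\<And>x. x \<in> U \<Longrightarrow> a < x"
  shows "(\<Sum>xs | length xs = q \<and> distinct xs \<and> set xs \<subseteq> U. z ^ ilis_length (a # xs)) =
    fact (card U) / fact (card U - q) * ilis_cycle_pgf z (Suc q)"
proof -
  let ?L = "{xs. length xs = q \<and> distinct xs \<and> set xs \<subseteq> U}"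
  have fin: "finite ?L" by (rule finite_subset[OF _ finite_subset_distinct[OF U]]) auto
  have count: "of_nat (card {xs \<in> ?L. sorted_wrt (<) (take j xs)}) = (fact (card U) / fact (card U - q) / fact j :: complex)"
    if "j \<le> q" for j
  proof -
    have "of_nat (card {xs \<in> ?L. sorted_wrt (<) (take j xs)} * (fact (card U - q) * fact j)) = (of_nat (fact (card U)) :: complex)"
      using card_lists_sorted_prefix[OF U that q] by (simp add: conj_assoc)
    then show ?thesis by (simp add: field_simps)
  qed
  have "(\<Sum>xs\<in>?L. z ^ ilis_length (a # xs)) =
      (\<Sum>xs\<in>?L. 1 + (z - 1) * (\<Sum>j<Suc q. if sorted_wrt (<) (take j xs) then z ^ j else 0))"
    using a by (intro sum.cong refl) (subst power_ilis_length_Cons, auto)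
  also have "\<dots> = of_nat (card ?L) + (z - 1) * (\<Sum>j<Suc q. \<Sum>xs\<in>?L. if sorted_wrt (<) (take j xs) then z ^ j else 0)"
    by (simp only: sum.distrib sum_distrib_left[symmetric] sum.swap[of _ "{..<Suc q}"]) simp
  also have "(\<Sum>j<Suc q. \<Sum>xs\<in>?L. if sorted_wrt (<) (take j xs) then z ^ j else 0) =
      (\<Sum>j<Suc q. fact (card U) / fact (card U - q) * (z ^ j / fact j))"
  proof (intro sum.cong refl)
    fix j assume "j \<in> {..<Suc q}"
    have "(\<Sum>xs\<in>?L. if sorted_wrt (<) (take j xs) then z ^ j else 0) = of_nat (card {xs \<in> ?L. sorted_wrt (<) (take j xs)}) * z ^ j"
      using fin by (subst sum.inter_filter[symmetric]) simp_all
    then show "(\<Sum>xs\<in>?L. if sorted_wrt (<) (take j xs) then z ^ j else 0) = fact (card U) / fact (card U - q) * (z ^ j / fact j)"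
      using count[of j] \<open>j \<in> _\<close> by simp
  qed
  also have "of_nat (card ?L) = (fact (card U) / fact (card U - q) :: complex)"
    using count[of 0] by simp
  finally show ?thesis
    by (simp only: ilis_cycle_pgf_def sum_distrib_left[symmetric] distrib_left mult_1_right mult.left_commute)
qed

lemma sum_cycles_from_min:
  fixes z :: complex
  assumes S: "finite S" "S \<noteq> {}"
  shows "(\<Sum>c\<in>cycles_from_min S. z ^ ilis_length c * h (length c)) =
    (\<Sum>k=1..card S. fact (card S - 1) / fact (card S - k) * ilis_cycle_pgf z k * h k)"
proof -
  let ?a = "Min S" and ?U = "S - {Min S}"
  have cardU: "card ?U = card S - 1" using S by simp
  have fin: "finite (cycles_from_min S)"
    by (rule finite_subset[OF _ finite_subset_distinct[OF S(1)]]) (auto simp: cycles_from_min_def)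
  have img: "length ` cycles_from_min S \<subseteq> {1..card S}"
  proof (intro image_subsetI)
    fix c assume "c \<in> cycles_from_min S"
    then have c: "c \<noteq> []" "distinct c" "set c \<subseteq> S" by (auto simp: cycles_from_min_def)
    then show "length c \<in> {1..card S}"
      using card_mono[OF S(1) c(3)] by (auto simp: distinct_card Suc_le_eq)
  qed
  have "(\<Sum>c\<in>cycles_from_min S. z ^ ilis_length c * h (length c)) =
      (\<Sum>k=1..card S. \<Sum>c\<in>{c \<in> cycles_from_min S. length c = k}. z ^ ilis_length c * h (length c))"
    using sum.group[OF fin _ img, of "\<lambda>c. z ^ ilis_length c * h (length c)"] by simp
  also have "\<dots> = (\<Sum>k=1..card S. fact (card S - 1) / fact (card S - k) * ilis_cycle_pgf z k * h k)"
  proof (intro sum.cong refl)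
    fix k assume k: "k \<in> {1..card S}"
    have "(\<Sum>c\<in>{c \<in> cycles_from_min S. length c = k}. z ^ ilis_length c * h (length c)) =
        (\<Sum>xs | length xs = k - 1 \<and> distinct xs \<and> set xs \<subseteq> ?U. z ^ ilis_length (?a # xs) * h k)"
    proof (rule sum.reindex_bij_witness[of _ "Cons ?a" tl], goal_cases)
      case (1 c) then show ?case by (cases c) (auto simp: cycles_from_min_def)
    next
      case (2 c) then show ?case by (cases c) (auto simp: cycles_from_min_def)
    next
      case (4 xs) then show ?case using k Min_in[OF S] by (auto simp: cycles_from_min_def)
    next
      case (5 c) then show ?case by (cases c) (auto simp: cycles_from_min_def)
    qed auto
    also have "\<dots> = fact (card ?U) / fact (card ?U - (k - 1)) * ilis_cycle_pgf z (Suc (k - 1)) * h k"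
      unfolding sum_distrib_right[symmetric]
      using S k by (subst sum_lists_power_ilis_length) (auto simp: cardU order.strict_iff_order)
    finally show "(\<Sum>c\<in>{c \<in> cycles_from_min S. length c = k}. z ^ ilis_length c * h (length c)) =
        fact (card S - 1) / fact (card S - k) * ilis_cycle_pgf z k * h k"
      using k by (simp add: cardU)
  qed
  finally show ?thesis .
qed

section \<open>The generating function of the sum over all cycles\<close>

text \<open>Defined by the recursion of the renewal argument; \<open>expectation_power_ilis_sum\<close> identifies it as the
  probability generating function of the sum over all cycles.\<close>

fun perm_pgf :: "complex \<Rightarrow> nat \<Rightarrow> complex" where
  "perm_pgf z n = (if n = 0 then 1 else (\<Sum>k=1..n. ilis_cycle_pgf z k * perm_pgf z (n - k)) / of_nat n)"

declare perm_pgf.simps [simp del]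

lemma perm_pgf_0: "perm_pgf z 0 = 1"
  by (subst perm_pgf.simps) simp

lemma perm_pgf_renewal:
  "n > 0 \<Longrightarrow> of_nat n * perm_pgf z n = (\<Sum>k=1..n. ilis_cycle_pgf z k * perm_pgf z (n - k))"
  by (subst perm_pgf.simps) simp

text \<open>Keeping the ground set arbitrary makes relabelling unnecessary: the induction itself shows that the
  sum depends only on the cardinality.\<close>

lemma sum_permutations_power_ilis:
  fixes z :: complex
  assumes "finite S"
  shows "(\<Sum>\<sigma> | \<sigma> permutes S. z ^ (\<Sum>c\<in>cycle_lists S \<sigma>. ilis_length c)) = fact (card S) * perm_pgf z (card S)"
  using assms
proof (induction "card S" arbitrary: S rule: less_induct)
  case less
  note S = less.prems
  let ?W = "\<lambda>S. \<Sum>\<sigma> | \<sigma> permutes S. z ^ (\<Sum>c\<in>cycle_lists S \<sigma>. ilis_length c)"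
  show ?case
  proof (cases "S = {}")
    case True
    have "cycle_lists {} id = {}" by (auto simp: cycle_lists_def)
    then show ?thesis using True by (simp add: perm_pgf_0)
  next
    case False
    have pos: "card S > 0" using S False by (simp add: card_gt_0_iff)
    have "?W S = (\<Sum>c\<in>cycles_from_min S. \<Sum>\<tau> | \<tau> permutes (S - set c).
        z ^ (\<Sum>d\<in>cycle_lists S (cycle_of_list c \<circ> \<tau>). ilis_length d))"
      by (rule sum_permutations_split_min_cycle[OF S False])
    also have "\<dots> = (\<Sum>c\<in>cycles_from_min S. z ^ ilis_length c * ?W (S - set c))"
      unfolding sum_distrib_left
    proof (intro sum.cong refl)
      fix c \<tau> assume "c \<in> cycles_from_min S" and "\<tau> \<in> {\<tau>. \<tau> permutes (S - set c)}"
      then have c: "c \<noteq> []" "distinct c" "set c \<subseteq> S" "hd c = Min S" and \<tau>: "\<tau> permutes (S - set c)"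
        by (auto simp: cycles_from_min_def)
      have "hd c = Min (set c)"
      proof (rule Min_eqI[symmetric])
        show "hd c \<in> set c" using c(1) by simp
        show "hd c \<le> x" if "x \<in> set c" for x
          using that c(3,4) S by auto
      qed simp
      then have "cycle_lists S (cycle_of_list c \<circ> \<tau>) = insert c (cycle_lists (S - set c) \<tau>)"
        by (intro cycle_lists_peel S c \<tau>)
      moreover have "c \<notin> cycle_lists (S - set c) \<tau>"
        using c(1) by (cases c) (auto simp: cycle_lists_def)
      ultimately show "z ^ (\<Sum>d\<in>cycle_lists S (cycle_of_list c \<circ> \<tau>). ilis_length d) =
          z ^ ilis_length c * z ^ (\<Sum>d\<in>cycle_lists (S - set c) \<tau>. ilis_length d)"
        using S by (simp add: finite_cycle_lists power_add)
    qed
    \<comment> \<open>By the induction hypothesis the remaining set only matters through its size.\<close>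
    also have "\<dots> = (\<Sum>c\<in>cycles_from_min S. z ^ ilis_length c * (fact (card S - length c) * perm_pgf z (card S - length c)))"
    proof (intro sum.cong refl)
      fix c assume "c \<in> cycles_from_min S"
      then have c: "c \<noteq> []" "distinct c" "set c \<subseteq> S" by (auto simp: cycles_from_min_def)
      then have "card (S - set c) = card S - length c"
        by (simp add: card_Diff_subset distinct_card)
      moreover have "\<dots> < card S" using c pos by simp
      ultimately show "z ^ ilis_length c * ?W (S - set c) = z ^ ilis_length c * (fact (card S - length c) * perm_pgf z (card S - length c))"
        using less.hyps[of "S - set c"] S by simp
    qed
    also have "\<dots> = (\<Sum>k=1..card S. fact (card S - 1) / fact (card S - k) * ilis_cycle_pgf z k * (fact (card S - k) * perm_pgf z (card S - k)))"
      by (rule sum_cycles_from_min[OF S False])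
    also have "\<dots> = fact (card S - 1) * (\<Sum>k=1..card S. ilis_cycle_pgf z k * perm_pgf z (card S - k))"
      unfolding sum_distrib_left by (intro sum.cong refl) simp
    also have "\<dots> = fact (card S - 1) * of_nat (card S) * perm_pgf z (card S)"
      using pos by (simp only: perm_pgf_renewal[symmetric] mult.assoc)
    also have "fact (card S - 1) * of_nat (card S) = (fact (card S) :: complex)"
      using pos by (metis fact_reduce mult.commute)
    finally show ?thesis .
  qed
qed

lemma expectation_power_ilis_sum:
  fixes z :: complex
  shows "(LINT \<sigma>|measure_pmf (uniform_perm n). z ^ ilis_sum n \<sigma>) = perm_pgf z n"
proof -
  let ?P = "{\<sigma>. \<sigma> permutes {1..n}}"
  have fin: "finite ?P" by (rule finite_permutations) simp
  have card: "card ?P = fact n" by (rule card_permutations) simp_all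
  have "id \<in> ?P" unfolding mem_Collect_eq by (rule permutes_id)
  then have ne: "?P \<noteq> {}" by (rule ex_in_conv[THEN iffD1, OF exI])
  have "(LINT \<sigma>|measure_pmf (uniform_perm n). z ^ ilis_sum n \<sigma>) = (\<Sum>\<sigma>\<in>?P. (1 / fact n) *\<^sub>R z ^ ilis_sum n \<sigma>)"
    unfolding uniform_perm_def
    by (subst integral_measure_pmf[OF fin]) (simp_all only: pmf_of_set[OF ne fin] set_pmf_of_set[OF ne fin] card indicator_simps of_nat_fact cong: sum.cong)
  also have "\<dots> = (\<Sum>\<sigma>\<in>?P. z ^ ilis_sum n \<sigma>) / fact n"
    by (simp add: sum_divide_distrib scaleR_conv_of_real)
  also have "(\<Sum>\<sigma>\<in>?P. z ^ ilis_sum n \<sigma>) = fact n * perm_pgf z n"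
    using sum_permutations_power_ilis[of "{1..n}" z] by (simp add: ilis_sum_def cycles_of_perm_eq)
  finally show ?thesis by simp
qed

section \<open>Comparison of two renewal recursions\<close>

text \<open>The difference \<open>d\<close> of the two sequences satisfies
  $n |d_n| \le \sum_{j<n} |d_j| + \delta$ with $d_0 = 0$, and the constant sequence \<open>\<delta>\<close> (from index 1 on)
  solves the corresponding equation.\<close>

lemma norm_diff_le_of_renewal:
  fixes a p f :: "nat \<Rightarrow> 'a::real_normed_field" and F :: 'a
  assumes a0: "a 0 = 1" and p0: "p 0 = 1"
    and a_rec: "\<And>n. n > 0 \<Longrightarrow> of_nat n * a n = (\<Sum>k=1..n. f k * a (n - k))"
    and p_rec: "\<And>n. n > 0 \<Longrightarrow> of_nat n * p n = (\<Sum>k=1..n. F * p (n - k))"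
    and f_le: "\<And>k. k > 0 \<Longrightarrow> norm (f k) \<le> 1"
    and p_le: "\<And>n. norm (p n) \<le> 1"
    and f_F: "\<And>n. (\<Sum>k=1..n. norm (f k - F)) \<le> \<delta>"
  shows "norm (a n - p n) \<le> \<delta>"
proof (induction n rule: less_induct)
  case (less n)
  have "\<delta> \<ge> 0" using f_F[of 0] by simp
  show ?case
  proof (cases "n = 0")
    case False
    have "of_nat n * (a n - p n) = (\<Sum>k=1..n. f k * a (n - k) - F * p (n - k))"
      using False by (simp add: right_diff_distrib a_rec p_rec sum_subtractf)
    also have "\<dots> = (\<Sum>k=1..n. f k * (a (n - k) - p (n - k)) + (f k - F) * p (n - k))"
      by (intro sum.cong refl) (simp add: algebra_simps)
    finally have eq: "of_nat n * (a n - p n) = \<dots>" .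
    have "n * norm (a n - p n) = norm (of_nat n * (a n - p n))"
      by (simp add: norm_mult)
    also have "\<dots> \<le> (\<Sum>k=1..n. norm (a (n - k) - p (n - k)) + norm (f k - F))"
      unfolding eq
      by (intro sum_norm_le norm_triangle_mono) (auto simp: norm_mult intro!: mult_left_le_one_le mult_right_le_one_le f_le p_le)
    \<comment> \<open>The summand with k = n vanishes because both sequences start at 1. The remaining n - 1
      summands leave exactly enough room for the perturbation, so the bound does not grow with n.\<close>
    also have "\<dots> \<le> (\<Sum>k=1..n. if k = n then 0 else \<delta>) + \<delta>"
      unfolding sum.distrib using less.IH f_F[of n]
      by (intro add_mono sum_mono) (auto simp: a0 p0)
    also have "(\<Sum>k=1..n. if k = n then 0 else \<delta>) = (\<Sum>k=1..<n. \<delta>)"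
      by (intro sum.mono_neutral_cong_right) auto
    also have "\<dots> + \<delta> = n * \<delta>"
      using False by (simp add: of_nat_diff algebra_simps)
    finally show ?thesis using False by simp
  qed (use \<open>\<delta> \<ge> 0\<close> in \<open>simp add: a0 p0\<close>)
qed

text \<open>The expectation of $(1+w)^C$ for the number $C$ of cycles of a uniform permutation of \<open>n\<close> points: the
  generating function that results if every cycle has the same weight.\<close>

definition ewens_prod :: "complex \<Rightarrow> nat \<Rightarrow> complex" where
  "ewens_prod w n = (\<Prod>k=1..n. 1 + w / of_nat k)"

lemma ewens_prod_renewal:
  assumes "n > 0"
  shows "of_nat n * ewens_prod w n = (\<Sum>k=1..n. (1 + w) * ewens_prod w (n - k))"
proof -
  have "of_nat n * ewens_prod w n = (1 + w) * (\<Sum>j<n. ewens_prod w j)"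
    using assms
  proof (induction n rule: nat_induct_non_zero)
    case (Suc n)
    have "of_nat (Suc n) * ewens_prod w (Suc n) = (of_nat (Suc n) + w) * ewens_prod w n"
      by (simp add: ewens_prod_def field_simps del: of_nat_Suc)
    also have "\<dots> = of_nat n * ewens_prod w n + (1 + w) * ewens_prod w n"
      by (simp add: algebra_simps)
    finally show ?case using Suc by (simp add: algebra_simps)
  qed (simp add: ewens_prod_def)
  also have "(\<Sum>j<n. ewens_prod w j) = (\<Sum>k=1..n. ewens_prod w (n - k))"
    by (rule sum.reindex_bij_witness[of _ "\<lambda>k. n - k" "\<lambda>k. n - k"]) (use assms in auto)
  finally show ?thesis by (simp add: sum_distrib_left)
qed

text \<open>The quantity is a convex combination of $1$ and $1 + w$, with weights $1 - 1/k$ and $1/k$.\<close>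

lemma norm_one_plus_div_le_one:
  fixes w :: "'a::real_normed_field"
  assumes "norm (1 + w) \<le> 1" and "k > 0"
  shows "norm (1 + w / of_nat k) \<le> 1"
proof -
  have "of_nat k * (1 + w / of_nat k) = of_nat (k - 1) + (1 + w)"
    using assms by (simp add: distrib_left of_nat_diff)
  then have "k * norm (1 + w / of_nat k) = norm (of_nat (k - 1) + (1 + w))"
    by (metis norm_mult norm_of_nat)
  also have "\<dots> \<le> real (k - 1) + 1"
    using assms by (intro norm_triangle_mono) (simp_all only: norm_of_nat order_refl)
  also have "\<dots> = k * 1" using assms by simp
  finally show ?thesis using assms by simp
qed

lemma norm_ewens_prod_le_one:
  "norm (1 + w) \<le> 1 \<Longrightarrow> norm (ewens_prod w n) \<le> 1"
  unfolding ewens_prod_def by (simp only: prod_norm[symmetric]) (auto intro!: prod_le_1 norm_one_plus_div_le_one)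

lemma norm_ilis_cycle_pgf_le_one:
  assumes "norm z = 1" and "k > 0"
  shows "norm (ilis_cycle_pgf z k) \<le> 1"
proof -
  \<comment> \<open>As a polynomial in z, the generating function for length k + 1 has coefficients P(l = m), the last of
    which is 1/k!. Removing that term makes the induction go through.\<close>
  have "norm (ilis_cycle_pgf z (Suc k) - z ^ Suc k / fact k) \<le> 1 - 1 / fact k" for k
  proof (induction k)
    case (Suc k)
    have fact_le: "1 / fact (Suc k) \<le> (1 / fact k :: real)"
      by (intro divide_left_mono fact_mono) auto
    have "ilis_cycle_pgf z (Suc (Suc k)) - z ^ Suc (Suc k) / fact (Suc k) =
        (ilis_cycle_pgf z (Suc k) - z ^ Suc k / fact k) + z ^ Suc k * of_real (1 / fact k - 1 / fact (Suc k))"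
      by (simp add: ilis_cycle_pgf_def algebra_simps diff_divide_distrib add_divide_distrib del: fact_Suc)
    also have "norm \<dots> \<le> (1 - 1 / fact k) + \<bar>1 / fact k - 1 / fact (Suc k)\<bar>"
      using Suc by (intro norm_triangle_mono) (simp_all only: norm_mult norm_power assms norm_of_real power_one mult_1_left order_refl)
    also have "\<dots> = 1 - 1 / fact (Suc k)"
      using fact_le by linarith
    finally show ?case .
  qed (simp add: ilis_cycle_pgf_def)
  from this[of "k - 1"] have *: "norm (ilis_cycle_pgf z k - z ^ k / fact (k - 1)) \<le> 1 - 1 / fact (k - 1)"
    using assms by simp
  have "norm (ilis_cycle_pgf z k) \<le> norm (ilis_cycle_pgf z k - z ^ k / fact (k - 1)) + norm (z ^ k / fact (k - 1))"
    by (metis norm_triangle_ineq diff_add_cancel)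
  also have "norm (z ^ k / fact (k - 1)) = 1 / fact (k - 1)"
    using assms by (simp add: norm_divide norm_power)
  finally show ?thesis using * by simp
qed

lemma power_over_fact_sums_exp:
  fixes z :: "'a::{real_normed_field,banach}"
  shows "(\<lambda>j. z ^ j / fact j) sums exp z"
  using exp_converges[of z] by (simp add: scaleR_conv_of_real divide_inverse mult.commute)

lemma ilis_cycle_pgf_tendsto:
  fixes z :: complex
  shows "ilis_cycle_pgf z \<longlonglongrightarrow> 1 + (z - 1) * exp z"
  using power_over_fact_sums_exp[of z]
  unfolding ilis_cycle_pgf_def sums_def by (intro tendsto_intros)

lemma norm_ilis_limit_pgf_le_one:
  fixes z :: complex
  assumes "norm z = 1"
  shows "norm (1 + (z - 1) * exp z) \<le> 1"
  by (rule LIMSEQ_le_const2[OF tendsto_norm[OF ilis_cycle_pgf_tendsto]])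
     (use norm_ilis_cycle_pgf_le_one[OF assms] in \<open>auto intro!: exI[of _ 1]\<close>)

text \<open>The deviation at \<open>k\<close> is at most $|z-1|$ times the tail $\sum_{j \ge k} 1/j!$, and these tails have
  the finite sum $e$.\<close>

lemma sum_ilis_cycle_pgf_error:
  assumes "norm z = 1"
  shows "(\<Sum>k=1..n. norm (ilis_cycle_pgf z k - (1 + (z - 1) * exp z))) \<le> exp 1 * norm (z - 1)"
proof -
  have exp1: "(\<lambda>j. 1 / fact j :: real) sums exp 1"
    using power_over_fact_sums_exp[of "1::real"] by simp
  have tail: "norm (ilis_cycle_pgf z k - (1 + (z - 1) * exp z))
      \<le> norm (z - 1) * (\<Sum>j. if k \<le> j then 1 / fact j else 0)" for k
  proof -
    have s: "(\<lambda>j. if k \<le> j then z ^ j / fact j else 0) sums (exp z - (\<Sum>j<k. z ^ j / fact j))"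
      using sums_diff[OF power_over_fact_sums_exp sums_If_finite_set[of "{..<k}" "\<lambda>j. z ^ j / fact j"]]
      by (rule sums_cong[THEN iffD1, rotated 1]) auto
    have "norm (exp z - (\<Sum>j<k. z ^ j / fact j)) \<le> (\<Sum>j. if k \<le> j then 1 / fact j else 0)"
      unfolding sums_unique[OF s]
      by (rule norm_suminf_le) (use assms sums_summable[OF exp1] in \<open>auto simp: norm_divide norm_power intro: summable_comparison_test'\<close>)
    then have "norm (z - 1) * norm (exp z - (\<Sum>j<k. z ^ j / fact j)) \<le> norm (z - 1) * (\<Sum>j. if k \<le> j then 1 / fact j else 0)"
      by (intro mult_left_mono) auto
    moreover have "ilis_cycle_pgf z k - (1 + (z - 1) * exp z) = - ((z - 1) * (exp z - (\<Sum>j<k. z ^ j / fact j)))"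
      by (simp add: ilis_cycle_pgf_def algebra_simps)
    ultimately show ?thesis by (simp only: norm_minus_cancel norm_mult)
  qed
  have summ: "summable (\<lambda>j. if k \<le> j then 1 / fact j else 0 :: real)" for k
    by (rule summable_comparison_test'[OF sums_summable[OF exp1]]) auto
  have "(\<Sum>k=1..n. norm (ilis_cycle_pgf z k - (1 + (z - 1) * exp z)))
      \<le> norm (z - 1) * (\<Sum>k=1..n. \<Sum>j. if k \<le> j then 1 / fact j else 0)"
    unfolding sum_distrib_left by (intro sum_mono tail)
  \<comment> \<open>Each term 1/j! occurs in the tails from k = 1, ..., j only, and the sum of j/j! is again e.\<close>
  also have "(\<Sum>k=1..n. \<Sum>j. if k \<le> j then 1 / fact j else 0 :: real) = (\<Sum>j. \<Sum>k=1..n. if k \<le> j then 1 / fact j else 0)"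
    using summ by (rule suminf_sum[symmetric])
  also have "norm (z - 1) * (\<Sum>j. \<Sum>k=1..n. if k \<le> j then 1 / fact j else 0 :: real) \<le> norm (z - 1) * exp 1"
  proof -
    have le: "(\<Sum>k=1..n. if k \<le> j then 1 / fact j else 0 :: real) \<le> j / fact j" for j
    proof -
      have "(\<Sum>k=1..n. if k \<le> j then 1 / fact j else 0 :: real) = real (card {k\<in>{1..n}. k \<le> j}) / fact j"
        by (simp add: sum.inter_filter[symmetric])
      also have "card {k\<in>{1..n}. k \<le> j} \<le> card {1..j}"
        by (intro card_mono) auto
      finally show ?thesis by (simp add: divide_right_mono)
    qed
    have sums: "(\<lambda>j. real j / fact j) sums exp 1"
    proof -
      have "real (Suc j) / fact (Suc j) = 1 / fact j" for j
        by (simp only: fact_Suc) (simp del: of_nat_Suc)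
      then show ?thesis
        using exp1 sums_Suc_iff[of "\<lambda>j. real j / fact j" "exp 1"] by simp
    qed
    show ?thesis
      unfolding sums_unique[OF sums]
      by (intro mult_left_mono norm_ge_zero suminf_le le sums_summable[OF sums] summable_sum summ)
  qed
  finally show ?thesis by (simp add: mult.commute)
qed

lemma perm_pgf_approx:
  assumes "norm z = 1" and "a 0 = 1"
    and "\<And>n. n > 0 \<Longrightarrow> of_nat n * a n = (\<Sum>k=1..n. ilis_cycle_pgf z k * a (n - k))"
  shows "norm (a n - ewens_prod ((z - 1) * exp z) n) \<le> exp 1 * norm (z - 1)"
proof (rule norm_diff_le_of_renewal[where f = "ilis_cycle_pgf z" and F = "1 + (z - 1) * exp z"])
  show "norm (ewens_prod ((z - 1) * exp z) n) \<le> 1" for n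
    by (intro norm_ewens_prod_le_one norm_ilis_limit_pgf_le_one assms)
qed (use assms in \<open>auto simp del: One_nat_def simp: ewens_prod_renewal ewens_prod_def[of _ 0]
       intro: norm_ilis_cycle_pgf_le_one sum_ilis_cycle_pgf_error\<close>)

section \<open>Asymptotics of the comparison product\<close>

lemma sum_inverse_squares_le_2: "(\<Sum>k=1..n. 1 / (real k)\<^sup>2) \<le> 2"
proof (cases "n = 0")
  case False
  then have "n > 0" by simp
  then have "(\<Sum>k=1..n. 1 / (real k)\<^sup>2) \<le> 2 - 1 / real n"
  proof (induction n rule: nat_induct_non_zero)
    case (Suc n)
    have "1 / (real (Suc n))\<^sup>2 \<le> 1 / (real n * real (Suc n))"
      using Suc.hyps by (intro divide_left_mono) (auto simp: power2_eq_square)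
    also have "\<dots> = 1 / real n - 1 / real (Suc n)"
      using Suc.hyps by (simp add: field_simps)
    finally show ?case using Suc.IH by simp
  qed simp
  then show ?thesis by (rule order_trans) simp
qed simp

text \<open>Factor by factor, $1 + w/k$ and $e^{w/k}$ differ by $O(|w|^2/k^2)$. All factors have norm at most 1 (for
  the exponentials since \<open>Re w \<le> 0\<close>), so these errors simply add up.\<close>

lemma ewens_prod_approx_exp:
  assumes "norm (1 + w) \<le> 1"
  shows "norm (ewens_prod w n - exp (w * of_real (harm n))) \<le> 2 * exp (norm w) * (norm w)\<^sup>2"
proof -
  have "Re w \<le> 0" using complex_Re_le_cmod[of "1 + w"] assms by simp
  have "exp (w * of_real (harm n)) = (\<Prod>k=1..n. exp (w / of_nat k))"
    by (simp add: harm_def exp_sum[symmetric] sum_distrib_left divide_inverse)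
  then have "norm (ewens_prod w n - exp (w * of_real (harm n)))
      \<le> (\<Sum>k=1..n. norm (1 + w / of_nat k - exp (w / of_nat k)))"
    unfolding ewens_prod_def using assms \<open>Re w \<le> 0\<close>
    by (simp only:, intro norm_prod_diff norm_one_plus_div_le_one)
       (auto simp: divide_le_0_iff)
  also have "\<dots> \<le> (\<Sum>k=1..n. exp (norm w) * (norm w)\<^sup>2 * (1 / (real k)\<^sup>2))"
  proof (intro sum_mono)
    fix k assume "k \<in> {1..n}"
    then have k: "k \<ge> 1" by simp
    have re: "\<bar>Re (w / of_nat k)\<bar> \<le> norm w"
    proof -
      have "\<bar>Re (w / of_nat k)\<bar> \<le> norm w / k"
        using abs_Re_le_cmod[of "w / of_nat k"] by (simp add: norm_divide)
      also have "\<dots> \<le> norm w"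
        using k by (simp add: divide_le_eq mult_le_cancel_left1)
      finally show ?thesis .
    qed
    have "norm (1 + w / of_nat k - exp (w / of_nat k)) \<le> exp \<bar>Re (w / of_nat k)\<bar> * (norm (w / of_nat k))\<^sup>2"
      using Taylor_exp[of "w / of_nat k" 1] by (simp add: norm_minus_commute power2_eq_square)
    also have "\<dots> \<le> exp (norm w) * (norm (w / of_nat k))\<^sup>2"
      using re by (intro mult_right_mono) auto
    finally show "norm (1 + w / of_nat k - exp (w / of_nat k)) \<le> exp (norm w) * (norm w)\<^sup>2 * (1 / (real k)\<^sup>2)"
      by (simp add: norm_divide power_divide)
  qed
  also have "\<dots> = exp (norm w) * (norm w)\<^sup>2 * (\<Sum>k=1..n. 1 / (real k)\<^sup>2)"
    by (simp add: sum_distrib_left)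
  also have "\<dots> \<le> exp (norm w) * (norm w)\<^sup>2 * 2"
    by (intro mult_left_mono sum_inverse_squares_le_2) auto
  finally show ?thesis by simp
qed

lemma exp_minus_1_over_tendsto: "((\<lambda>u::complex. (exp u - 1) / u) \<longlongrightarrow> 1) (at 0)"
  using DERIV_exp[of "0::complex"] by (simp add: DERIV_def)

lemma exp_second_order_tendsto: "((\<lambda>u::complex. (exp u - 1 - u) / u\<^sup>2) \<longlongrightarrow> 1 / 2) (at 0)"
proof -
  have "((\<lambda>u::complex. exp (norm u) * norm u / 2) \<longlongrightarrow> exp (norm (0::complex)) * norm (0::complex) / 2) (at 0)"
    by (intro tendsto_intros) simp
  then have lim: "((\<lambda>u::complex. exp (norm u) * norm u / 2) \<longlongrightarrow> 0) (at 0)" by simp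
  have "((\<lambda>u::complex. (exp u - 1 - u) / u\<^sup>2 - 1 / 2) \<longlongrightarrow> 0) (at 0)"
  proof (rule Lim_null_comparison[OF _ lim])
    show "\<forall>\<^sub>F u::complex in at 0. norm ((exp u - 1 - u) / u\<^sup>2 - 1 / 2) \<le> exp (norm u) * norm u / (2::real)"
      using eventually_neq_at_within[of "0::complex" 0 UNIV]
    proof eventually_elim
      case (elim u)
      then have "u \<noteq> 0" by simp
      have "norm ((exp u - 1 - u) / u\<^sup>2 - 1 / 2) * (norm u)\<^sup>2 = norm (((exp u - 1 - u) / u\<^sup>2 - 1 / 2) * u\<^sup>2)"
        by (simp add: norm_mult norm_power)
      also have "((exp u - 1 - u) / u\<^sup>2 - 1 / 2) * u\<^sup>2 = exp u - (\<Sum>k\<le>2. u ^ k / fact k)"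
        using \<open>u \<noteq> 0\<close> by (simp add: field_simps numeral_2_eq_2)
      also have "norm \<dots> \<le> exp (norm u) * norm u ^ Suc 2 / fact 2"
        by (rule Taylor_exp_field)
      also have "\<dots> = exp (norm u) * norm u / 2 * (norm u)\<^sup>2"
        by (simp add: power2_eq_square power3_eq_cube)
      finally show ?case
        using \<open>u \<noteq> 0\<close> by (simp add: mult_le_cancel_right)
    qed
  qed
  then show ?thesis by (simp add: LIM_zero_iff)
qed

text \<open>The coefficient of \<open>u\<close> here is the mean $e$ of the limiting length distribution and $3e/2$ is half its
  second moment; multiplied by the logarithm of \<open>n\<close> they give the centring and the variance of the sum.\<close>

lemma ilis_exponent_second_order:
  "((\<lambda>u::complex. ((exp u - 1) * exp (exp u) - exp 1 * u) / u\<^sup>2) \<longlongrightarrow> 3 * exp 1 / 2) (at 0)"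
proof -
  \<comment> \<open>With y = exp u - 1 the exponent is e * y * exp y. Both y - u and y * (exp y - 1) contribute at
    second order, with coefficients 1/2 and 1.\<close>
  define y :: "complex \<Rightarrow> complex" where "y u = exp u - 1" for u
  have yu: "((\<lambda>u. y u / u) \<longlongrightarrow> 1) (at 0)"
    using exp_minus_1_over_tendsto by (simp add: y_def)
  have "(y \<longlongrightarrow> exp 0 - 1) (at 0)"
    unfolding y_def by (intro tendsto_intros)
  moreover have ne: "\<forall>\<^sub>F u in at 0. y u \<noteq> 0"
    using tendsto_imp_eventually_ne[OF yu, of 0] by (auto elim: eventually_mono)
  ultimately have "filterlim y (at 0) (at 0)"
    by (simp add: filterlim_at)
  then have ey: "((\<lambda>u. (exp (y u) - 1) / y u) \<longlongrightarrow> 1) (at 0)"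
    by (rule filterlim_compose[OF exp_minus_1_over_tendsto])
  have "((\<lambda>u. exp 1 * ((exp u - 1 - u) / u\<^sup>2 + (y u / u)\<^sup>2 * ((exp (y u) - 1) / y u))) \<longlongrightarrow>
      exp 1 * (1 / 2 + 1\<^sup>2 * 1)) (at 0)"
    by (intro tendsto_intros exp_second_order_tendsto yu ey)
  then show ?thesis
  proof (rule Lim_transform_eventually[THEN tendsto_eq_rhs])
    show "\<forall>\<^sub>F u in at 0. exp 1 * ((exp u - 1 - u) / u\<^sup>2 + (y u / u)\<^sup>2 * ((exp (y u) - 1) / y u)) =
        ((exp u - 1) * exp (exp u) - exp 1 * u) / u\<^sup>2"
      using ne eventually_neq_at_within[of 0 0 UNIV]
    proof (eventually_elim, goal_cases)
      case (1 u)
      have "exp (exp u) = exp 1 * exp (y u)"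
        by (simp add: y_def exp_add[symmetric])
      moreover have "exp u = y u + 1" by (simp add: y_def)
      ultimately have "((exp u - 1) * exp (exp u) - exp 1 * u) / u\<^sup>2 = (y u * (exp 1 * exp (y u)) - exp 1 * u) / u\<^sup>2"
        by simp
      also have "\<dots> = exp 1 * ((y u - u) / u\<^sup>2 + (y u / u)\<^sup>2 * ((exp (y u) - 1) / y u))"
        using 1 by (simp add: field_simps power2_eq_square)
      finally show ?case by (simp add: y_def)
    qed
  qed simp
qed

text \<open>Here \<open>u\<close> is $i\theta$ for the normalised argument $\theta = t/\sqrt{3e \log n}$.\<close>

lemma ewens_prod_normal_limit:
  fixes t :: real and u w :: "nat \<Rightarrow> complex"
  assumes "t \<noteq> 0"
  defines "u \<equiv> \<lambda>n. \<i> * of_real (t / sqrt (3 * exp 1 * ln (real n)))"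
  defines "w \<equiv> \<lambda>n. (exp (u n) - 1) * exp (exp (u n))"
  shows "(\<lambda>n. exp (- (u n * of_real (exp 1 * ln (real n)))) * ewens_prod (w n) n) \<longlonglongrightarrow> of_real (exp (- t\<^sup>2 / 2))"
    and "u \<longlonglongrightarrow> 0"
proof -
  have "(\<lambda>n. t / sqrt (3 * exp 1 * ln (real n))) \<longlonglongrightarrow> 0"
    by real_asymp
  from tendsto_mult_left[OF tendsto_of_real[OF this], of "\<i>"]
  show u0: "u \<longlonglongrightarrow> 0" by (simp add: u_def)
  have "\<forall>\<^sub>F n in sequentially. u n \<noteq> 0"
    using eventually_gt_at_top[of 1] by eventually_elim (use assms in \<open>auto simp: u_def\<close>)
  with u0 have u_at: "filterlim u (at 0) sequentially"
    by (simp add: filterlim_at)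
  have "(\<lambda>n. (exp (u n) - 1) * exp (exp (u n))) \<longlonglongrightarrow> (exp 0 - 1) * exp (exp 0)"
    by (intro tendsto_intros u0)
  then have w0: "w \<longlonglongrightarrow> 0" by (simp add: w_def)
  have exp_lim: "(\<lambda>n. exp (w n * of_real (harm n) - u n * of_real (exp 1 * ln (real n)))) \<longlonglongrightarrow> of_real (exp (- t\<^sup>2 / 2))"
  proof -
    \<comment> \<open>Split off the bounded difference between harmonic number and logarithm. What remains is
      (w - e * u) * ln n, which equals (w - e * u) / u^2 * (- t^2 / (3 * e)).\<close>
    have second_order: "(\<lambda>n. (w n - exp 1 * u n) / (u n)\<^sup>2) \<longlonglongrightarrow> 3 * exp 1 / 2"
      unfolding w_def by (rule filterlim_compose[OF ilis_exponent_second_order u_at])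
    have "(\<lambda>n. w n * of_real (harm n - ln (real n)) + (w n - exp 1 * u n) / (u n)\<^sup>2 * of_real (- t\<^sup>2 / (3 * exp 1)))
        \<longlonglongrightarrow> 0 * of_real euler_mascheroni + 3 * exp 1 / 2 * of_real (- t\<^sup>2 / (3 * exp 1))"
      by (intro tendsto_add tendsto_mult tendsto_of_real tendsto_const w0 euler_mascheroni_LIMSEQ second_order)
    moreover have "\<forall>\<^sub>F n in sequentially.
        w n * of_real (harm n - ln (real n)) + (w n - exp 1 * u n) / (u n)\<^sup>2 * of_real (- t\<^sup>2 / (3 * exp 1)) =
        w n * of_real (harm n) - u n * of_real (exp 1 * ln (real n))"
      using eventually_gt_at_top[of 1]
    proof eventually_elim
      case (elim n)
      then have ln: "ln (real n) > 0" by simp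
      have "(u n)\<^sup>2 = - of_real ((t / sqrt (3 * exp 1 * ln (real n)))\<^sup>2)"
        by (simp only: u_def power_mult_distrib i_squared of_real_power) simp
      also have "(t / sqrt (3 * exp 1 * ln (real n)))\<^sup>2 = t\<^sup>2 / (3 * exp 1 * ln (real n))"
        using ln by (simp add: power_divide)
      finally have u2: "(u n)\<^sup>2 * of_real (ln (real n)) = of_real (- t\<^sup>2 / (3 * exp 1))"
        using ln by simp
      have "u n \<noteq> 0" using ln assms by (auto simp: u_def)
      then have "(w n - exp 1 * u n) / (u n)\<^sup>2 * of_real (- t\<^sup>2 / (3 * exp 1)) = (w n - exp 1 * u n) * of_real (ln (real n))"
        unfolding u2[symmetric] by simp
      then show ?case
        by (simp add: algebra_simps exp_of_real[symmetric])
    qed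
    ultimately have "(\<lambda>n. w n * of_real (harm n) - u n * of_real (exp 1 * ln (real n))) \<longlonglongrightarrow> of_real (- t\<^sup>2 / 2)"
      by (rule Lim_transform_eventually[THEN tendsto_eq_rhs]) (simp add: exp_of_real[symmetric])
    from tendsto_exp[OF this] show ?thesis by (simp only: exp_of_real)
  qed
  have "(\<lambda>n. exp (- (u n * of_real (exp 1 * ln (real n)))) * ewens_prod (w n) n
      - exp (w n * of_real (harm n) - u n * of_real (exp 1 * ln (real n)))) \<longlonglongrightarrow> 0"
  proof (rule Lim_null_comparison)
    have "(\<lambda>n. 2 * exp (norm (w n)) * (norm (w n))\<^sup>2) \<longlonglongrightarrow> 2 * exp (norm (0::complex)) * (norm (0::complex))\<^sup>2"
      by (intro tendsto_intros w0)
    then show "(\<lambda>n. 2 * exp (norm (w n)) * (norm (w n))\<^sup>2) \<longlonglongrightarrow> 0" by simp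
    show "\<forall>\<^sub>F n in sequentially. norm (exp (- (u n * of_real (exp 1 * ln (real n)))) * ewens_prod (w n) n
      - exp (w n * of_real (harm n) - u n * of_real (exp 1 * ln (real n)))) \<le> 2 * exp (norm (w n)) * (norm (w n))\<^sup>2"
    proof (intro always_eventually allI)
      fix n
      have "norm (exp (u n)) = 1" by (simp add: u_def)
      from norm_ilis_limit_pgf_le_one[OF this] have w1: "norm (1 + w n) \<le> 1" by (simp add: w_def)
      have "exp (- (u n * of_real (exp 1 * ln (real n)))) * ewens_prod (w n) n
        - exp (w n * of_real (harm n) - u n * of_real (exp 1 * ln (real n)))
        = exp (- (u n * of_real (exp 1 * ln (real n)))) * (ewens_prod (w n) n - exp (w n * of_real (harm n)))"
        by (simp add: right_diff_distrib mult_exp_exp)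
      moreover have "norm (exp (- (u n * of_real (exp 1 * ln (real n))))) = 1"
        by (simp add: u_def)
      ultimately show "norm (exp (- (u n * of_real (exp 1 * ln (real n)))) * ewens_prod (w n) n
        - exp (w n * of_real (harm n) - u n * of_real (exp 1 * ln (real n)))) \<le> 2 * exp (norm (w n)) * (norm (w n))\<^sup>2"
        using ewens_prod_approx_exp[OF w1] by (simp only: norm_mult mult_1_left)
    qed
  qed
  from Lim_transform[OF exp_lim this]
  show "(\<lambda>n. exp (- (u n * of_real (exp 1 * ln (real n)))) * ewens_prod (w n) n) \<longlonglongrightarrow> of_real (exp (- t\<^sup>2 / 2))" .
qed

section \<open>The central limit theorem\<close>

lemma char_ilis_sum_normalized:
  "char (distr (measure_pmf (uniform_perm n)) borel (ilis_sum_normalized n)) t =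
    exp (- (\<i> * of_real (t / sqrt (3 * exp 1 * ln (real n))) * of_real (exp 1 * ln (real n)))) *
    perm_pgf (exp (\<i> * of_real (t / sqrt (3 * exp 1 * ln (real n))))) n"
proof -
  define u where "u = \<i> * complex_of_real (t / sqrt (3 * exp 1 * ln (real n)))"
  have "char (distr (measure_pmf (uniform_perm n)) borel (ilis_sum_normalized n)) t =
      (LINT \<sigma>|measure_pmf (uniform_perm n). iexp (t * ilis_sum_normalized n \<sigma>))"
    unfolding char_def by (subst integral_distr) auto
  also have "\<dots> = (LINT \<sigma>|measure_pmf (uniform_perm n). exp (- (u * of_real (exp 1 * ln (real n)))) * exp u ^ ilis_sum n \<sigma>)"
  proof (rule Bochner_Integration.integral_cong[OF refl])
    fix \<sigma>
    have "\<i> * of_real (t * ilis_sum_normalized n \<sigma>) = - (u * of_real (exp 1 * ln (real n))) + of_nat (ilis_sum n \<sigma>) * u"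
      by (simp add: u_def ilis_sum_normalized_def diff_divide_distrib algebra_simps)
    then show "iexp (t * ilis_sum_normalized n \<sigma>) = exp (- (u * of_real (exp 1 * ln (real n)))) * exp u ^ ilis_sum n \<sigma>"
      by (simp only: exp_add exp_of_nat_mult)
  qed
  also have "\<dots> = exp (- (u * of_real (exp 1 * ln (real n)))) * perm_pgf (exp u) n"
    by (simp add: expectation_power_ilis_sum)
  finally show ?thesis unfolding u_def .
qed

lemma char_ilis_sum_normalized_tendsto:
  "(\<lambda>n. char (distr (measure_pmf (uniform_perm n)) borel (ilis_sum_normalized n)) t)
    \<longlonglongrightarrow> char std_normal_distribution t"
proof (cases "t = 0")
  case True
  have "real_distribution (distr (measure_pmf (uniform_perm n)) borel (ilis_sum_normalized n))" for n
    by (intro prob_space.real_distribution_distr measure_pmf.prob_space_axioms) simp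
  then show ?thesis
    using True by (simp add: real_distribution.char_zero real_dist_normal_dist)
next
  case False
  define u where "u n = \<i> * complex_of_real (t / sqrt (3 * exp 1 * ln (real n)))" for n
  define r where "r n = exp (- (u n * of_real (exp 1 * ln (real n))))" for n
  note lim = ewens_prod_normal_limit[OF False, folded u_def, folded r_def]
  have "(\<lambda>n. r n * perm_pgf (exp (u n)) n - r n * ewens_prod ((exp (u n) - 1) * exp (exp (u n))) n) \<longlonglongrightarrow> 0"
  proof (rule Lim_null_comparison)
    have "(\<lambda>n. exp 1 * norm (exp (u n) - 1)) \<longlonglongrightarrow> exp 1 * norm (exp 0 - (1::complex))"
      by (intro tendsto_intros lim(2))
    then show "(\<lambda>n. exp 1 * norm (exp (u n) - 1)) \<longlonglongrightarrow> 0" by simp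
    show "\<forall>\<^sub>F n in sequentially. norm (r n * perm_pgf (exp (u n)) n - r n * ewens_prod ((exp (u n) - 1) * exp (exp (u n))) n)
        \<le> exp 1 * norm (exp (u n) - 1)"
    proof (intro always_eventually allI)
      fix n
      have "norm (perm_pgf (exp (u n)) n - ewens_prod ((exp (u n) - 1) * exp (exp (u n))) n) \<le> exp 1 * norm (exp (u n) - 1)"
      proof (rule perm_pgf_approx[where a = "perm_pgf (exp (u n))"])
        show "norm (exp (u n)) = 1" by (simp add: u_def)
        show "perm_pgf (exp (u n)) 0 = 1" by (simp add: perm_pgf_0)
        show "of_nat m * perm_pgf (exp (u n)) m = (\<Sum>k=1..m. ilis_cycle_pgf (exp (u n)) k * perm_pgf (exp (u n)) (m - k))"
          if "m > 0" for m
          using that by (rule perm_pgf_renewal)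
      qed
      moreover have "norm (r n) = 1" by (simp add: r_def u_def)
      ultimately show "norm (r n * perm_pgf (exp (u n)) n - r n * ewens_prod ((exp (u n) - 1) * exp (exp (u n))) n)
          \<le> exp 1 * norm (exp (u n) - 1)"
        by (simp only: right_diff_distrib[symmetric] norm_mult mult_1_left)
    qed
  qed
  from Lim_transform[OF lim(1) this] show ?thesis
    by (simp only: char_ilis_sum_normalized char_std_normal_distribution u_def r_def)
qed

lemma cdf_std_normal_distribution:
  "cdf std_normal_distribution u = 1 / sqrt (2 * pi) * (LBINT v:{..u}. exp (- v\<^sup>2 / 2))"
proof -
  interpret real_distribution std_normal_distribution by (rule real_dist_normal_dist)
  have "cdf std_normal_distribution u = (LINT v|std_normal_distribution. indicator {..u} v)"
    by (simp add: cdf_def)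
  also have "\<dots> = (LBINT v. std_normal_density v * indicator {..u} v)"
    by (subst integral_density) auto
  also have "\<dots> = (LBINT v. 1 / sqrt (2 * pi) * (indicator {..u} v * exp (- v\<^sup>2 / 2)))"
    by (intro Bochner_Integration.integral_cong refl) (simp add: std_normal_density_def)
  also have "\<dots> = 1 / sqrt (2 * pi) * (LBINT v:{..u}. exp (- v\<^sup>2 / 2))"
    by (simp add: set_lebesgue_integral_def)
  finally show ?thesis .
qed

lemma isCont_cdf_std_normal_distribution: "isCont (cdf std_normal_distribution) u"
proof -
  interpret real_distribution std_normal_distribution by (rule real_dist_normal_dist)
  have "emeasure std_normal_distribution {u} = 0"
    by (subst emeasure_density) (auto simp: nn_integral_null_set)
  then show ?thesis by (simp add: isCont_cdf measure_def)
qed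

theorem theorem1:
  shows "weak_conv_m
           (\<lambda>n. distr (measure_pmf (uniform_perm n)) borel (ilis_sum_normalized n))
           std_normal_distribution
       \<and> (\<forall>u::real.
           (\<lambda>n. measure_pmf.prob (uniform_perm n) {\<sigma>. ilis_sum_normalized n \<sigma> \<le> u})
             \<longlonglongrightarrow> 1 / sqrt (2 * pi) * (LBINT v:{..u}. exp (- v\<^sup>2 / 2)))"
proof (intro conjI allI)
  show conv: "weak_conv_m (\<lambda>n. distr (measure_pmf (uniform_perm n)) borel (ilis_sum_normalized n))
      std_normal_distribution"
    by (intro levy_continuity real_dist_normal_dist char_ilis_sum_normalized_tendsto
        prob_space.real_distribution_distr measure_pmf.prob_space_axioms) simp
  fix u :: real
  have "(\<lambda>n. cdf (distr (measure_pmf (uniform_perm n)) borel (ilis_sum_normalized n)) u)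
      \<longlonglongrightarrow> cdf std_normal_distribution u"
    using conv isCont_cdf_std_normal_distribution by (auto simp: weak_conv_m_def weak_conv_def)
  moreover have "cdf (distr (measure_pmf (uniform_perm n)) borel (ilis_sum_normalized n)) u =
      measure_pmf.prob (uniform_perm n) {\<sigma>. ilis_sum_normalized n \<sigma> \<le> u}" for n
    unfolding cdf_def by (subst measure_distr) (auto simp: vimage_def)
  ultimately show "(\<lambda>n. measure_pmf.prob (uniform_perm n) {\<sigma>. ilis_sum_normalized n \<sigma> \<le> u})
      \<longlonglongrightarrow> 1 / sqrt (2 * pi) * (LBINT v:{..u}. exp (- v\<^sup>2 / 2))"
    by (simp add: cdf_std_normal_distribution)
qed

end
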